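(* Let $\mathbb{F}$ be an algebraically closed field with $\mathrm{Char}(\mathbb{F})\neq 2,3$, and let $B_i$ ($i=1,\dots,11$), with the corresponding parameters in $\mathbb{F}$, be the $3$-algebra generated by the $2$-dimensional binary algebra $A_i$ of the list given in the context. Among all the $3$-algebras $B_1(\alpha_1,\alpha_2,\alpha_4,\beta_1)$, $B_2(\alpha_1,\beta_1,\beta_2)$, $B_3(\beta_1,\beta_2)$, $B_4(\alpha_1,\beta_2)$, $B_5(\alpha_1)$, $B_6(\alpha_1,\beta_1)$, $B_7(\beta_1)$, $B_8(\alpha_1)$, $B_9$, $B_{10}$, $B_{11}$, those that are totally associative are exactly: (i) $B_2(\alpha_1,\beta_1,\beta_2)$ with $(\alpha_1,\beta_1,\beta_2)\in\{(0,0,0),\ (\tfrac12,0,-\tfrac12),\ (\tfrac12,0,\tfrac12)\}$; (ii) $B_4(\alpha_1,\beta_2)$ with $(\alpha_1,\beta_2)\in\{(0,0),\ (\tfrac12,-\tfrac12),\ (\tfrac12,0),\ (\tfrac12,\tfrac12),\ (1,-1),\ (1,0),\ (1,1)\}$. Consequently the following (nonzero) totally associative $3$-algebras are obtained, given by their matrices of structure constants: $$B_2(0,0,0)=\left(\begin{array}{cccccccc}0&0&0&0&0&0&1&0\\0&0&0&0&0&0&0&1\end{array}\right),$$ $$B_2(\tfrac12,0,-\tfrac12)=\left(\begin{array}{cccccccc}\frac14&0&0&\frac12&0&-\frac12&\frac12&0\\0&\frac14&-\frac14&0&\frac14&0&0&\frac12\end{array}\right),$$ $$B_2(\tfrac12,0,\tfrac12)=\left(\begin{array}{cccccccc}\frac14&0&0&\frac12&0&\frac12&\frac12&0\\0&\frac14&\frac14&0&\frac14&0&0&\frac12\end{array}\right),$$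 $$B_4(\tfrac12,-\tfrac12)=\left(\begin{array}{cccccccc}\frac14&0&0&0&0&0&0&0\\0&\frac14&-\frac14&0&\frac14&0&0&0\end{array}\right),$$ $$B_4(\tfrac12,0)=\left(\begin{array}{cccccccc}\frac14&0&0&0&0&0&0&0\\0&0&0&0&\frac14&0&0&0\end{array}\right),$$ $$B_4(\tfrac12,\tfrac12)=\left(\begin{array}{cccccccc}\frac14&0&0&0&0&0&0&0\\0&\frac14&\frac14&0&\frac14&0&0&0\end{array}\right),$$ $$B_4(1,-1)=B_4(1,1)=\left(\begin{array}{cccccccc}1&0&0&0&0&0&0&0\\0&1&0&0&0&0&0&0\end{array}\right),$$ $$B_4(1,0)=\left(\begin{array}{cccccccc}1&0&0&0&0&0&0&0\\0&0&0&0&0&0&0&0\end{array}\right).$$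
   Context: Let $V=\mathbb{F}e_1\oplus\mathbb{F}e_2$. A $3$-algebra on $V$ is a trilinear map $f:V\times V\times V\to V$, written $f(u,v,w)=u\cdot v\cdot w$. Its matrix of structure constants is the $2\times 8$ matrix $A$ whose columns, indexed by $(i,j,k)$ in the order $111,112,121,122,211,212,221,222$, are the coordinate vectors of $f(e_i,e_j,e_k)$. The $3$-algebra is totally associative if $$(u\cdot v\cdot w)\cdot x\cdot y=u\cdot(v\cdot w\cdot x)\cdot y=u\cdot v\cdot(w\cdot x\cdot y)\quad\text{for all }u,v,w,x,y\in V;$$ equivalently, with $I$ the $2\times2$ identity matrix and $\otimes$ the Kronecker product, $A(A\otimes I\otimes I-I\otimes A\otimes I)=0$, $A(A\otimes I\otimes I-I\otimes I\otimes A)=0$ and $A(I\otimes A\otimes I-I\otimes I\otimes A)=0$. A binary algebra on $V$ is a bilinear map $\mu:V\times V\to V$; its matrix of structure constants is the $2\times 4$ matrix whose columns are the coordinate vectors of $\mu(e_1,e_1),\mu(e_1,e_2),\mu(e_2,e_1),\mu(e_2,e_2)$ in this order. The $3$-algebra generated by $(V,\mu)$ is $(V,f_\mu)$ with $f_\mu(x,y,z)=\mu(x,\mu(y,z))$. $B_i$ denotes the $3$-algebra generated by $A_i$ (with the same parameters), where the binary algebras $A_i$ are given by the following matrices of structure constants (rows separated by semicolons, parameters in $\mathbb{F}$): $A_1(\alpha_1,\alpha_2,\alpha_4,\beta_1)=(\alpha_1,\alpha_2,\alpha_2+1,\alpha_4;\ \beta_1,-\alpha_1,-\alpha_1+1,-\alpha_2)$;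 $A_2(\alpha_1,\beta_1,\beta_2)=(\alpha_1,0,0,1;\ \beta_1,\beta_2,1-\alpha_1,0)$; $A_3(\beta_1,\beta_2)=(0,1,1,0;\ \beta_1,\beta_2,1,-1)$; $A_4(\alpha_1,\beta_2)=(\alpha_1,0,0,0;\ 0,\beta_2,1-\alpha_1,0)$; $A_5(\alpha_1)=(\alpha_1,0,0,0;\ 1,2\alpha_1-1,1-\alpha_1,0)$; $A_6(\alpha_1,\beta_1)=(\alpha_1,0,0,1;\ \beta_1,1-\alpha_1,-\alpha_1,0)$; $A_7(\beta_1)=(0,1,1,0;\ \beta_1,1,0,-1)$; $A_8(\alpha_1)=(\alpha_1,0,0,0;\ 0,1-\alpha_1,-\alpha_1,0)$; $A_9=(\tfrac13,0,0,0;\ 1,\tfrac23,-\tfrac13,0)$; $A_{10}=(0,1,1,0;\ 0,0,0,-1)$; $A_{11}=(0,1,1,0;\ 1,0,0,-1)$. *)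

theory Defs
  imports
    "HOL-Analysis.Cartesian_Space"
    "HOL-Computational_Algebra.Computational_Algebra"
begin

text \<open>The space V is \<open>'a ^ 2\<close>, with basis \<open>axis 1 1\<close>, \<open>axis 2 1\<close>. Numeral index types
  are cyclic, so the last index of \<open>'a ^ n\<close> is \<open>n = 0\<close>; \<^const>\<open>vector\<close> lists the entries in
  the order \<open>1, ..., n\<close>.\<close>

type_synonym 'a bin_op = "'a ^ 2 \<Rightarrow> 'a ^ 2 \<Rightarrow> 'a ^ 2"
type_synonym 'a ter_op = "'a ^ 2 \<Rightarrow> 'a ^ 2 \<Rightarrow> 'a ^ 2 \<Rightarrow> 'a ^ 2"

definition e1 :: "'a::field ^ 2" where "e1 = axis 1 1"
definition e2 :: "'a::field ^ 2" where "e2 = axis 2 1"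

definition binary_algebra :: "'a::field bin_op \<Rightarrow> bool" where
  "binary_algebra \<mu> \<longleftrightarrow>
     (\<forall>y. Vector_Spaces.linear (*s) (*s) (\<lambda>x. \<mu> x y)) \<and>
     (\<forall>x. Vector_Spaces.linear (*s) (*s) (\<lambda>y. \<mu> x y))"

definition three_algebra :: "'a::field ter_op \<Rightarrow> bool" where
  "three_algebra f \<longleftrightarrow>
     (\<forall>v w. Vector_Spaces.linear (*s) (*s) (\<lambda>u. f u v w)) \<and>
     (\<forall>u w. Vector_Spaces.linear (*s) (*s) (\<lambda>v. f u v w)) \<and>
     (\<forall>u v. Vector_Spaces.linear (*s) (*s) (\<lambda>w. f u v w))"

definition totally_associative :: "'a::field ter_op \<Rightarrow> bool" where
  "totally_associative f \<longleftrightarrow> three_algebra f \<and>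
     (\<forall>u v w x y. f (f u v w) x y = f u (f v w x) y \<and>
                  f u (f v w x) y = f u v (f w x y))"

text \<open>The vectors listed in the following two definitions are the columns of the matrix, hence
  the transpositions.\<close>

definition bin_structure_matrix :: "'a::field bin_op \<Rightarrow> 'a ^ 4 ^ 2" where
  "bin_structure_matrix \<mu> = transpose (vector [\<mu> e1 e1, \<mu> e1 e2, \<mu> e2 e1, \<mu> e2 e2])"

definition structure_matrix :: "'a::field ter_op \<Rightarrow> 'a ^ 8 ^ 2" where
  "structure_matrix f = transpose (vector
     [f e1 e1 e1, f e1 e1 e2, f e1 e2 e1, f e1 e2 e2,
      f e2 e1 e1, f e2 e1 e2, f e2 e2 e1, f e2 e2 e2])"

text \<open>The binary algebra with matrix of structure constants \<open>M\<close>: x . y is M applied to the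
  Kronecker product of x and y.\<close>

definition bin_alg_of :: "'a::field ^ 4 ^ 2 \<Rightarrow> 'a bin_op" where
  "bin_alg_of M x y = M *v vector [x$1 * y$1, x$1 * y$2, x$2 * y$1, x$2 * y$2]"

definition generated_3alg :: "'a::field bin_op \<Rightarrow> 'a ter_op" where
  "generated_3alg \<mu> x y z = \<mu> x (\<mu> y z)"

lemma vector_4_nth:
  "(vector [a, b, c, d] :: 'a::zero ^ 4) $ 1 = a"
  "(vector [a, b, c, d] :: 'a::zero ^ 4) $ 2 = b"
  "(vector [a, b, c, d] :: 'a::zero ^ 4) $ 3 = c"
  "(vector [a, b, c, d] :: 'a::zero ^ 4) $ 4 = d"
  unfolding vector_def by simp_all

lemma vector_8_nth:
  "(vector [a, b, c, d, e, f, g, h] :: 'a::zero ^ 8) $ 1 = a"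
  "(vector [a, b, c, d, e, f, g, h] :: 'a::zero ^ 8) $ 2 = b"
  "(vector [a, b, c, d, e, f, g, h] :: 'a::zero ^ 8) $ 3 = c"
  "(vector [a, b, c, d, e, f, g, h] :: 'a::zero ^ 8) $ 4 = d"
  "(vector [a, b, c, d, e, f, g, h] :: 'a::zero ^ 8) $ 5 = e"
  "(vector [a, b, c, d, e, f, g, h] :: 'a::zero ^ 8) $ 6 = f"
  "(vector [a, b, c, d, e, f, g, h] :: 'a::zero ^ 8) $ 7 = g"
  "(vector [a, b, c, d, e, f, g, h] :: 'a::zero ^ 8) $ 8 = h"
  unfolding vector_def by simp_all

lemma binary_algebra_bin_alg_of: "binary_algebra (bin_alg_of M)"
  unfolding binary_algebra_def bin_alg_of_def
  by (auto intro!: Vector_Spaces.linear_iff[THEN iffD2] vec.vector_space_axioms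
      simp: vec_eq_iff matrix_vector_mult_def sum_4 vector_4_nth algebra_simps)

lemma bin_structure_matrix_bin_alg_of: "bin_structure_matrix (bin_alg_of M) = M"
  by (simp add: bin_structure_matrix_def bin_alg_of_def vec_eq_iff forall_2 forall_4
      matrix_vector_mult_def sum_4 vector_4_nth transpose_def e1_def e2_def axis_def)

lemma bin_alg_of_bin_structure_matrix:
  assumes "binary_algebra \<mu>"
  shows "bin_alg_of (bin_structure_matrix \<mu>) = \<mu>"
proof (intro ext)
  fix x y :: "'a ^ 2"
  have L: "\<mu> (a *s u + b *s v) z = a *s \<mu> u z + b *s \<mu> v z"
    and R: "\<mu> z (a *s u + b *s v) = a *s \<mu> z u + b *s \<mu> z v" for a b u v z
    using assms unfolding binary_algebra_def Vector_Spaces.linear_iff by simp_all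
  have x: "x = x$1 *s e1 + x$2 *s e2" and y: "y = y$1 *s e1 + y$2 *s e2"
    by (simp_all add: vec_eq_iff forall_2 e1_def e2_def axis_def)
  have "\<mu> x y = (x$1 * y$1) *s \<mu> e1 e1 + (x$1 * y$2) *s \<mu> e1 e2
      + (x$2 * y$1) *s \<mu> e2 e1 + (x$2 * y$2) *s \<mu> e2 e2"
    by (subst x, subst y) (simp add: L R vec_eq_iff algebra_simps)
  then show "bin_alg_of (bin_structure_matrix \<mu>) x y = \<mu> x y"
    by (simp add: bin_structure_matrix_def bin_alg_of_def vec_eq_iff
        matrix_vector_mult_def sum_4 vector_4_nth transpose_def algebra_simps)
qed

lemma three_algebra_generated_3alg:
  assumes "binary_algebra \<mu>"
  shows "three_algebra (generated_3alg \<mu>)"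
  using assms unfolding binary_algebra_def three_algebra_def generated_3alg_def
    Vector_Spaces.linear_iff by simp

definition A1 :: "'a::field \<Rightarrow> 'a \<Rightarrow> 'a \<Rightarrow> 'a \<Rightarrow> 'a bin_op" where
  "A1 \<alpha>1 \<alpha>2 \<alpha>4 \<beta>1 = bin_alg_of (vector
     [vector [\<alpha>1, \<alpha>2, \<alpha>2 + 1, \<alpha>4],
      vector [\<beta>1, - \<alpha>1, - \<alpha>1 + 1, - \<alpha>2]])"

definition A2 :: "'a::field \<Rightarrow> 'a \<Rightarrow> 'a \<Rightarrow> 'a bin_op" where
  "A2 \<alpha>1 \<beta>1 \<beta>2 = bin_alg_of (vector
     [vector [\<alpha>1, 0, 0, 1],
      vector [\<beta>1, \<beta>2, 1 - \<alpha>1, 0]])"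

definition A3 :: "'a::field \<Rightarrow> 'a \<Rightarrow> 'a bin_op" where
  "A3 \<beta>1 \<beta>2 = bin_alg_of (vector
     [vector [0, 1, 1, 0],
      vector [\<beta>1, \<beta>2, 1, - 1]])"

definition A4 :: "'a::field \<Rightarrow> 'a \<Rightarrow> 'a bin_op" where
  "A4 \<alpha>1 \<beta>2 = bin_alg_of (vector
     [vector [\<alpha>1, 0, 0, 0],
      vector [0, \<beta>2, 1 - \<alpha>1, 0]])"

definition A5 :: "'a::field \<Rightarrow> 'a bin_op" where
  "A5 \<alpha>1 = bin_alg_of (vector
     [vector [\<alpha>1, 0, 0, 0],
      vector [1, 2 * \<alpha>1 - 1, 1 - \<alpha>1, 0]])"

definition A6 :: "'a::field \<Rightarrow> 'a \<Rightarrow> 'a bin_op" where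
  "A6 \<alpha>1 \<beta>1 = bin_alg_of (vector
     [vector [\<alpha>1, 0, 0, 1],
      vector [\<beta>1, 1 - \<alpha>1, - \<alpha>1, 0]])"

definition A7 :: "'a::field \<Rightarrow> 'a bin_op" where
  "A7 \<beta>1 = bin_alg_of (vector
     [vector [0, 1, 1, 0],
      vector [\<beta>1, 1, 0, - 1]])"

definition A8 :: "'a::field \<Rightarrow> 'a bin_op" where
  "A8 \<alpha>1 = bin_alg_of (vector
     [vector [\<alpha>1, 0, 0, 0],
      vector [0, 1 - \<alpha>1, - \<alpha>1, 0]])"

definition A9 :: "'a::field bin_op" where
  "A9 = bin_alg_of (vector
     [vector [1 / 3, 0, 0, 0],
      vector [1, 2 / 3, - (1 / 3), 0]])"

definition A10 :: "'a::field bin_op" where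
  "A10 = bin_alg_of (vector
     [vector [0, 1, 1, 0],
      vector [0, 0, 0, - 1]])"

definition A11 :: "'a::field bin_op" where
  "A11 = bin_alg_of (vector
     [vector [0, 1, 1, 0],
      vector [1, 0, 0, - 1]])"

definition B1 :: "'a::field \<Rightarrow> 'a \<Rightarrow> 'a \<Rightarrow> 'a \<Rightarrow> 'a ter_op" where
  "B1 \<alpha>1 \<alpha>2 \<alpha>4 \<beta>1 = generated_3alg (A1 \<alpha>1 \<alpha>2 \<alpha>4 \<beta>1)"
definition B2 :: "'a::field \<Rightarrow> 'a \<Rightarrow> 'a \<Rightarrow> 'a ter_op" where
  "B2 \<alpha>1 \<beta>1 \<beta>2 = generated_3alg (A2 \<alpha>1 \<beta>1 \<beta>2)"
definition B3 :: "'a::field \<Rightarrow> 'a \<Rightarrow> 'a ter_op" where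
  "B3 \<beta>1 \<beta>2 = generated_3alg (A3 \<beta>1 \<beta>2)"
definition B4 :: "'a::field \<Rightarrow> 'a \<Rightarrow> 'a ter_op" where
  "B4 \<alpha>1 \<beta>2 = generated_3alg (A4 \<alpha>1 \<beta>2)"
definition B5 :: "'a::field \<Rightarrow> 'a ter_op" where
  "B5 \<alpha>1 = generated_3alg (A5 \<alpha>1)"
definition B6 :: "'a::field \<Rightarrow> 'a \<Rightarrow> 'a ter_op" where
  "B6 \<alpha>1 \<beta>1 = generated_3alg (A6 \<alpha>1 \<beta>1)"
definition B7 :: "'a::field \<Rightarrow> 'a ter_op" where
  "B7 \<beta>1 = generated_3alg (A7 \<beta>1)"
definition B8 :: "'a::field \<Rightarrow> 'a ter_op" where
  "B8 \<alpha>1 = generated_3alg (A8 \<alpha>1)"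
definition B9 :: "'a::field ter_op" where
  "B9 = generated_3alg A9"
definition B10 :: "'a::field ter_op" where
  "B10 = generated_3alg A10"
definition B11 :: "'a::field ter_op" where
  "B11 = generated_3alg A11"

end

theory Submission
  imports Defs
begin

text \<open>The associative members of the list are associative for two structural reasons.

  If \<open>p\<close> is an associative product, \<open>\<sigma>\<close> an endomorphism of \<open>p\<close> with \<open>\<sigma>\<^sup>3 = \<sigma>\<close>, and
  \<open>\<mu> x y = p x (\<sigma> y)\<close>, then the generated 3-algebra is \<open>x (\<sigma> y) (\<sigma>\<^sup>2 z)\<close>, and all three
  bracketings of five factors are \<open>u (\<sigma> v) (\<sigma>\<^sup>2 w) (\<sigma> x) (\<sigma>\<^sup>2 y)\<close>. When \<open>\<alpha>\<^sub>1 = 1/2\<close>, the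
  algebras \<open>A\<^sub>2(1/2, 0, \<plusminus>1/2)\<close> and \<open>A\<^sub>4(1/2, \<beta>\<^sub>2)\<close> with \<open>2\<beta>\<^sub>2 \<in> {-1, 0, 1}\<close> are of this form:
  \<open>p\<close> is a multiple of the multiplication of a quadratic algebra with basis \<open>1, t\<close>, where \<open>t\<^sup>2\<close>
  is a scalar (zero for \<open>A\<^sub>4\<close>), and \<open>\<sigma>\<close> multiplies \<open>t\<close> by \<open>2\<beta>\<^sub>2\<close>
  (\<open>totally_associative_twisted_product\<close>, \<open>totally_associative_twisted_quadratic\<close>).

  If \<open>\<mu> x y\<close> is \<open>D y\<close> scaled by \<open>\<phi> x\<close>, with a functional \<open>\<phi>\<close> and a linear map \<open>D\<close>, the
  3-algebra is \<open>D\<^sup>2 z\<close> scaled by \<open>(\<phi> x) (\<phi> y)\<close>, which is totally associative as soon as \<open>D\<^sup>2\<close> is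
  idempotent and preserves \<open>\<phi>\<close> (\<open>totally_associative_functional_times_map\<close>). This covers
  \<open>A\<^sub>2(0, 0, 0)\<close> and \<open>A\<^sub>4(1, \<beta>\<^sub>2)\<close> with \<open>\<beta>\<^sub>2 \<in> {-1, 0, 1}\<close>. What remains, \<open>B\<^sub>4(0, 0)\<close>, is zero.

  Conversely, each coordinate of the associativity law at a word of five basis vectors is a
  polynomial equation in the parameters. In every family a few well chosen words give equations
  that can be solved by factoring, or that have no solution. The characteristic enters through
  the numerical factors of these equations: for \<open>B\<^sub>3\<close>, \<open>B\<^sub>5\<close>, \<open>B\<^sub>1\<^sub>0\<close> and \<open>B\<^sub>1\<^sub>1\<close> the contradiction
  is \<open>2 = 0\<close>, and for \<open>B\<^sub>9\<close> it is \<open>(1/3)\<^sup>2 = 0\<close>.\<close>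

section \<open>Coordinates\<close>

lemma exhaust_8:
  fixes i :: 8
  shows "i = 1 \<or> i = 2 \<or> i = 3 \<or> i = 4 \<or> i = 5 \<or> i = 6 \<or> i = 7 \<or> i = 8"
proof (induct i)
  case (of_int z)
  then have "z = 0 \<or> z = 1 \<or> z = 2 \<or> z = 3 \<or> z = 4 \<or> z = 5 \<or> z = 6 \<or> z = 7"
    by auto
  then show ?case by auto
qed

lemma forall_8:
  "(\<forall>i::8. P i) \<longleftrightarrow> P 1 \<and> P 2 \<and> P 3 \<and> P 4 \<and> P 5 \<and> P 6 \<and> P 7 \<and> P 8"
  by (metis exhaust_8)

text \<open>These two equations, together with the definitions of the families, turn each coordinate of a
  nested product into a polynomial in the parameters and the coordinates of the factors, so that
  every associativity condition is settled by ring normalisation.\<close>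

lemma bin_alg_of_nth:
  fixes x y :: "'a::field ^ 2"
  shows "bin_alg_of (vector [vector [p1, p2, p3, p4], vector [q1, q2, q3, q4]]) x y $ 1 =
      p1 * (x$1 * y$1) + p2 * (x$1 * y$2) + p3 * (x$2 * y$1) + p4 * (x$2 * y$2)"
    and "bin_alg_of (vector [vector [p1, p2, p3, p4], vector [q1, q2, q3, q4]]) x y $ 2 =
      q1 * (x$1 * y$1) + q2 * (x$1 * y$2) + q3 * (x$2 * y$1) + q4 * (x$2 * y$2)"
  by (simp_all add: bin_alg_of_def matrix_vector_mult_def sum_4 vector_4_nth)

lemma e_nth:
  "e1 $ 1 = 1" "e1 $ 2 = 0" "e2 $ 1 = 0" "e2 $ 2 = 1"
  by (simp_all add: e1_def e2_def axis_def)

lemmas A_defs = A1_def A2_def A3_def A4_def A5_def A6_def A7_def A8_def A9_def A10_def A11_def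
lemmas B_defs = B1_def B2_def B3_def B4_def B5_def B6_def B7_def B8_def B9_def B10_def B11_def

lemmas B_nth = B_defs A_defs generated_3alg_def bin_alg_of_nth

lemma totally_associativeD:
  fixes f :: "'a::field ter_op"
  assumes "totally_associative f"
  shows "f (f u v w) x y $ i = f u (f v w x) y $ i"
    and "f u (f v w x) y $ i = f u v (f w x y) $ i"
    and "f (f u v w) x y $ i = f u v (f w x y) $ i"
  using assms unfolding totally_associative_def by metis+

section \<open>Two sources of total associativity\<close>

text \<open>The exponents of \<open>\<sigma>\<close> at the successive factors of the five-fold products are \<open>0, 1, 2, 1, 2\<close>
  or \<open>0, 1, 2, 3, 2\<close> or \<open>0, 1, 2, 3, 4\<close>, according to whether the inner product is the first,
  second or third argument; \<open>\<sigma>\<^sup>3 = \<sigma>\<close> identifies them. Asking for \<open>\<sigma>\<^sup>3 = \<sigma>\<close> rather than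
  \<open>\<sigma>\<^sup>2 = 1\<close> admits idempotent \<open>\<sigma>\<close> as well, which \<open>B\<^sub>4(1/2, 0)\<close> needs.\<close>

lemma totally_associative_twisted_product:
  fixes \<mu> p :: "'a::field bin_op" and \<sigma> :: "'a ^ 2 \<Rightarrow> 'a ^ 2"
  assumes \<mu>: "binary_algebra \<mu>" "\<And>x y. \<mu> x y = p x (\<sigma> y)"
    and assoc: "\<And>x y z. p (p x y) z = p x (p y z)"
    and hom: "\<And>x y. \<sigma> (p x y) = p (\<sigma> x) (\<sigma> y)"
    and cube: "\<And>x. \<sigma> (\<sigma> (\<sigma> x)) = \<sigma> x"
  shows "totally_associative (generated_3alg \<mu>)"
  using three_algebra_generated_3alg[OF \<mu>(1)]
  by (simp add: totally_associative_def generated_3alg_def \<mu>(2) assoc hom cube)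

lemma totally_associative_functional_times_map:
  fixes \<mu> :: "'a::field bin_op" and \<phi> :: "'a ^ 2 \<Rightarrow> 'a" and D :: "'a ^ 2 \<Rightarrow> 'a ^ 2"
  assumes \<mu>: "binary_algebra \<mu>" "\<And>x y. \<mu> x y = \<phi> x *s D y"
    and scale: "\<And>k x. \<phi> (k *s x) = k * \<phi> x" "\<And>k x. D (k *s x) = k *s D x"
    and idem: "\<And>x. D (D (D (D x))) = D (D x)"
    and inv: "\<And>x. \<phi> (D (D x)) = \<phi> x"
  shows "totally_associative (generated_3alg \<mu>)"
  using three_algebra_generated_3alg[OF \<mu>(1)]
  by (simp add: totally_associative_def generated_3alg_def \<mu>(2) scale idem inv mult.assoc)

text \<open>For \<open>h \<noteq> 0\<close> the product \<open>p\<close> below is \<open>h\<close> times that of the algebra with basis \<open>1, t\<close> and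
  \<open>t\<^sup>2 = k / h\<close>. The map \<open>\<sigma>\<close> fixes \<open>1\<close> and sends \<open>t\<close> to \<open>s t\<close>; it respects \<open>t\<^sup>2\<close> because of the
  second assumption. For \<open>k = 0\<close> the factor \<open>s\<close> may also vanish, which is why \<open>B\<^sub>4\<close> has one more
  associative member at \<open>\<alpha>\<^sub>1 = 1/2\<close> than \<open>B\<^sub>2\<close>.\<close>

lemma totally_associative_twisted_quadratic:
  fixes h k s :: "'a::field"
  assumes s: "s ^ 3 = s" and k: "k * s\<^sup>2 = k"
  shows "totally_associative (generated_3alg (bin_alg_of (vector
    [vector [h, 0, 0, k * s], vector [0, h * s, h, 0]])))"
proof (rule totally_associative_twisted_product[OF binary_algebra_bin_alg_of])
  let ?p = "bin_alg_of (vector [vector [h, 0, 0, k], vector [0, h, h, 0]])"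
  let ?\<sigma> = "\<lambda>y :: 'a ^ 2. vector [y $ 1, s * y $ 2] :: 'a ^ 2"
  fix x y z :: "'a ^ 2"
  show "bin_alg_of (vector [vector [h, 0, 0, k * s], vector [0, h * s, h, 0]]) x y = ?p x (?\<sigma> y)"
    by (simp add: vec_eq_iff forall_2 bin_alg_of_nth)
  show "?p (?p x y) z = ?p x (?p y z)"
    by (simp add: vec_eq_iff forall_2 bin_alg_of_nth algebra_simps)
  have "s * (s * x) = x \<or> k = 0" for x using k by (auto simp: power2_eq_square)
  then show "?\<sigma> (?p x y) = ?p (?\<sigma> x) (?\<sigma> y)"
    using k by (auto simp add: vec_eq_iff forall_2 bin_alg_of_nth algebra_simps power2_eq_square)
  show "?\<sigma> (?\<sigma> (?\<sigma> x)) = ?\<sigma> x"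
    using s by (simp add: vec_eq_iff forall_2 power3_eq_cube flip: mult.assoc)
qed

section \<open>Associativity conditions in each family\<close>

text \<open>The words are chosen to eliminate one parameter after another: \<open>\<alpha>\<^sub>4 = 0\<close>, then \<open>\<alpha>\<^sub>2 = 0\<close>. After that
  \<open>\<beta>\<^sub>1\<close> drops out of the remaining two equations, one of which makes \<open>\<alpha>\<^sub>1\<close> nilpotent while the
  other makes it \<open>1\<close>.\<close>

lemma B1_not_totally_associative:
  fixes \<alpha>1 \<alpha>2 \<alpha>4 \<beta>1 :: "'a::field"
  shows "\<not> totally_associative (B1 \<alpha>1 \<alpha>2 \<alpha>4 \<beta>1)"
proof
  assume "totally_associative (B1 \<alpha>1 \<alpha>2 \<alpha>4 \<beta>1)"
  note * = totally_associativeD[OF this]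
  have "\<alpha>1 * \<alpha>4 + \<alpha>2 * \<alpha>4 = 0"
    using *(2)[of e1 e2 e2 e2 e2 1] unfolding B_nth e_nth by algebra
  moreover have "\<alpha>1 * \<alpha>4 + \<alpha>2 * \<alpha>4 = \<alpha>4"
    using *(2)[of e2 e2 e2 e1 e2 1] unfolding B_nth e_nth by algebra
  ultimately have \<alpha>4: "\<alpha>4 = 0" by simp
  have "\<alpha>1 * \<alpha>2\<^sup>2 = 0"
    using *(1)[of e1 e2 e1 e2 e2 1] unfolding B_nth e_nth \<alpha>4 by algebra
  moreover have "\<alpha>1 * \<alpha>2 ^ 3 + \<alpha>2\<^sup>2 = 0"
    using *(1)[of e1 e2 e2 e1 e2 1] unfolding B_nth e_nth \<alpha>4 by algebra
  ultimately have \<alpha>2: "\<alpha>2 = 0" by auto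
  have "\<alpha>1\<^sup>2 = 0"
    using *(2)[of e1 e2 e2 e1 e2 2] unfolding B_nth e_nth \<alpha>4 \<alpha>2 by algebra
  moreover have "\<alpha>1 = 1"
    using *(1)[of e2 e2 e2 e1 e1 2] unfolding B_nth e_nth \<alpha>4 \<alpha>2 by algebra
  ultimately show False by simp
qed

text \<open>The parameter \<open>a\<close> has two possible values, and \<open>c\<^sup>2 = a (1 - a)\<close>: the value \<open>a = 0\<close> forces
  \<open>c = 0\<close>, whereas \<open>a = 1/2\<close> forces \<open>c\<^sup>2 = 1/4\<close>.\<close>

lemma B2_necessary:
  fixes a b c :: "'a::field"
  assumes "totally_associative (B2 a b c)" and 2: "(2::'a) \<noteq> 0"
  shows "(a, b, c) \<in> {(0, 0, 0), (1/2, 0, - (1/2)), (1/2, 0, 1/2)}"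
proof -
  note * = totally_associativeD[OF assms(1)]
  have b: "b = 0"
    using *(1)[of e2 e1 e2 e2 e1 1] unfolding B_nth e_nth by algebra
  have a: "a * (2 * a - 1) = 0"
    using *(1)[of e1 e2 e2 e2 e2 1] unfolding B_nth e_nth by algebra
  have c: "c\<^sup>2 = a * (1 - a)"
    using *(1)[of e2 e2 e1 e2 e2 1] unfolding B_nth e_nth by algebra
  from a consider "a = 0" | "2 * a = 1" by auto
  then show ?thesis
  proof cases
    case 1
    then show ?thesis using b c by simp
  next
    case 2
    then have "(2 * c - 1) * (2 * c + 1) = 0" using c by algebra
    then have "2 * c = 1 \<or> 2 * c = - 1" by (auto simp: eq_neg_iff_add_eq_0)
    then show ?thesis using 2 b \<open>(2::'a) \<noteq> 0\<close> by (auto simp: field_simps)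
  qed
qed

text \<open>At \<open>a = b = c = 0\<close> the product is \<open>x\<^sub>2\<close> times the exchange of the coordinates of \<open>y\<close>. At \<open>a = 1/2\<close>
  it is a twisted quadratic algebra with \<open>h = 1/2\<close> and \<open>k = s = 2c\<close>.\<close>

lemma B2_sufficient:
  fixes a b c :: "'a::field"
  assumes "(a, b, c) \<in> {(0, 0, 0), (1/2, 0, - (1/2)), (1/2, 0, 1/2)}" and two: "(2::'a) \<noteq> 0"
  shows "totally_associative (B2 a b c)"
proof -
  consider "a = 0" "b = 0" "c = 0" | "a = 1/2" "b = 0" "c = - (1/2) \<or> c = 1/2"
    using assms(1) by auto
  then show ?thesis
  proof cases
    case 1
    have "totally_associative (generated_3alg (A2 0 0 (0::'a)))"
    proof (rule totally_associative_functional_times_map)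
      show "binary_algebra (A2 0 0 (0::'a))"
        unfolding A2_def by (rule binary_algebra_bin_alg_of)
      show "A2 0 0 0 x y = x $ 2 *s vector [y $ 2, y $ 1]" for x y :: "'a ^ 2"
        by (simp add: vec_eq_iff forall_2 A2_def bin_alg_of_nth)
    qed (simp_all add: vec_eq_iff forall_2)
    then show ?thesis using 1 by (simp add: B2_def)
  next
    case 2
    define s where "s = 2 * c"
    have s: "s = 1 \<or> s = - 1" using 2(3) two by (auto simp: s_def mult.commute[of 2 c])
    have *: "1 = s * s" using s by auto
    have "c = a * s" "1 - a = a" using 2(1) two by (simp_all add: s_def field_simps)
    note * = * this
    have "s ^ 3 = s" "s * s\<^sup>2 = s" using s by auto
    from totally_associative_twisted_quadratic[OF this, of a] show ?thesis
      unfolding B2_def A2_def by (simp add: *(2,3) 2(2) flip: *(1))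
  qed
qed

lemma B3_not_totally_associative:
  fixes a b :: "'a::field"
  assumes 2: "(2::'a) \<noteq> 0"
  shows "\<not> totally_associative (B3 a b)"
proof
  assume "totally_associative (B3 a b)"
  note * = totally_associativeD[OF this]
  have "(2::'a) = 0"
    using *(1)[of e1 e2 e2 e2 e2 1] by (simp add: B_nth e_nth)
  then show False using 2 by contradiction
qed

text \<open>One word gives \<open>a \<in> {0, 1/2, 1}\<close>, another \<open>c \<in> {0, a, - a}\<close>. This leaves seven pairs, because the
  three choices of \<open>c\<close> coincide when \<open>a = 0\<close>.\<close>

lemma B4_necessary:
  fixes a c :: "'a::field"
  assumes "totally_associative (B4 a c)" and 2: "(2::'a) \<noteq> 0"
  shows "(a, c) \<in> {(0, 0), (1/2, - (1/2)), (1/2, 0), (1/2, 1/2), (1, - 1), (1, 0), (1, 1)}"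
proof -
  note * = totally_associativeD[OF assms(1)]
  have a: "a\<^sup>2 * ((2 * a - 1) * (a - 1)) = 0"
    using *(1)[of e2 e1 e1 e1 e1 2] unfolding B_nth e_nth by algebra
  have c: "c\<^sup>2 * ((c - a) * (c + a)) = 0"
    using *(2)[of e1 e1 e1 e1 e2 2] unfolding B_nth e_nth by algebra
  have "a = 0 \<or> 2 * a = 1 \<or> a = 1" using a by auto
  moreover have "c = 0 \<or> c = a \<or> c = - a" using c by (auto simp: eq_neg_iff_add_eq_0)
  ultimately show ?thesis using 2 by (auto simp: field_simps)
qed

lemma B4_0_0: "B4 0 0 = (\<lambda>x y z. 0 :: 'a::field ^ 2)"
  by (intro ext) (simp add: vec_eq_iff forall_2 B_nth)

text \<open>At \<open>a = 1/2\<close> the product is that of the dual numbers scaled by \<open>1/2\<close>, twisted by the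
  endomorphism that multiplies the nilpotent basis element by \<open>2c\<close>. At \<open>a = 1\<close> it is \<open>x\<^sub>1\<close> times
  the diagonal map with entries \<open>1, c\<close>.\<close>

lemma B4_sufficient:
  fixes a c :: "'a::field"
  assumes "(a, c) \<in> {(0, 0), (1/2, - (1/2)), (1/2, 0), (1/2, 1/2), (1, - 1), (1, 0), (1, 1)}"
    and two: "(2::'a) \<noteq> 0"
  shows "totally_associative (B4 a c)"
proof -
  consider "a = 0" "c = 0" | "a = 1/2" "c \<in> {- (1/2), 0, 1/2}" | "a = 1" "c \<in> {- 1, 0, 1}"
    using assms(1) by auto
  then show ?thesis
  proof cases
    case 1
    have "three_algebra (B4 a c)"
      unfolding B4_def A4_def
      by (intro three_algebra_generated_3alg binary_algebra_bin_alg_of)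
    then show ?thesis
      using 1 by (simp add: totally_associative_def B4_0_0)
  next
    case 2
    define s where "s = 2 * c"
    have "s = 0 \<or> s = 1 \<or> s = - 1"
      using 2(2) two by (auto simp: s_def mult.commute[of 2 c])
    then have s: "s ^ 3 = s" by auto
    have *: "c = a * s" "1 - a = a"
      using 2 two by (auto simp: s_def field_simps)
    from totally_associative_twisted_quadratic[OF s, of 0 a] show ?thesis
      unfolding B4_def A4_def by (simp add: *)
  next
    case 3
    have "totally_associative (generated_3alg (A4 1 c))"
    proof (rule totally_associative_functional_times_map)
      show "binary_algebra (A4 1 c)"
        unfolding A4_def by (rule binary_algebra_bin_alg_of)
      show "A4 1 c x y = x $ 1 *s vector [y $ 1, c * y $ 2]" for x y :: "'a ^ 2"
        by (simp add: vec_eq_iff forall_2 A4_def bin_alg_of_nth)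
    qed (use 3(2) in \<open>auto simp: vec_eq_iff forall_2\<close>)
    then show ?thesis using 3 by (simp add: B4_def)
  qed
qed

text \<open>The only common root of the first two equations is \<open>a = 1\<close>: the other root \<open>a = 1/3\<close> of the first
  does not satisfy the second. At \<open>a = 1\<close> the third equation reads \<open>2 = 0\<close>.\<close>

lemma B5_not_totally_associative:
  fixes a :: "'a::field"
  assumes 2: "(2::'a) \<noteq> 0"
  shows "\<not> totally_associative (B5 a)"
proof
  assume "totally_associative (B5 a)"
  note * = totally_associativeD[OF this]
  have "(a - 1)\<^sup>2 * (3 * a - 1) = 0"
    using *(1)[of e1 e1 e1 e1 e1 2] unfolding B_nth e_nth by algebra
  moreover have "a\<^sup>2 * ((2 * a - 1) * (a - 1)) = 0"
    using *(1)[of e2 e1 e1 e1 e1 2] unfolding B_nth e_nth by algebra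
  moreover have s: "18 * a ^ 3 - 27 * a\<^sup>2 + 13 * a - 2 = 0"
    using *(2)[of e1 e1 e1 e1 e1 2] unfolding B_nth e_nth by algebra
  ultimately consider "a = 1" | "3 * a = 1" "a\<^sup>2 * (2 * a - 1) = 0" by fastforce
  then show False
  proof cases
    case 1
    then show False using s 2 by simp
  next
    case 2
    then have "a = 0" by algebra
    then show False using 2 by simp
  qed
qed

lemma B6_not_totally_associative:
  fixes a b :: "'a::field"
  assumes 2: "(2::'a) \<noteq> 0"
  shows "\<not> totally_associative (B6 a b)"
proof
  assume "totally_associative (B6 a b)"
  note * = totally_associativeD[OF this]
  have "b = 0"
    using *(3)[of e1 e1 e1 e2 e2 2] unfolding B_nth e_nth by algebra
  moreover have "2 * a\<^sup>2 = 0"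
    using *(1)[of e1 e2 e2 e2 e2 1] unfolding B_nth e_nth by algebra
  then have "a = 0" using 2 by simp
  moreover have "2 * a ^ 3 - 5 * a\<^sup>2 + 4 * a = 1"
    using *(3)[of e1 e1 e1 e1 e2 2] unfolding B_nth e_nth by algebra
  ultimately show False by simp
qed

lemma B7_not_totally_associative: "\<not> totally_associative (B7 (b :: 'a::field))"
proof
  assume "totally_associative (B7 b)"
  note * = totally_associativeD[OF this]
  have "(1::'a) = 0"
    using *(3)[of e1 e1 e1 e1 e2 1] unfolding B_nth e_nth by algebra
  then show False by simp
qed

lemma B8_not_totally_associative:
  fixes a :: "'a::field"
  assumes 2: "(2::'a) \<noteq> 0"
  shows "\<not> totally_associative (B8 a)"
proof
  assume "totally_associative (B8 a)"
  note * = totally_associativeD[OF this]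
  have "2 * a ^ 4 = 0"
    using *(1)[of e2 e1 e1 e1 e1 2] unfolding B_nth e_nth by algebra
  then have "a = 0" using 2 by simp
  moreover have "2 * a ^ 3 - 5 * a\<^sup>2 + 4 * a = 1"
    using *(2)[of e1 e1 e1 e1 e2 2] unfolding B_nth e_nth by algebra
  ultimately show False by simp
qed

lemma B9_not_totally_associative:
  assumes 3: "(3::'a::field) \<noteq> 0"
  shows "\<not> totally_associative (B9 :: 'a ter_op)"
proof
  assume "totally_associative (B9 :: 'a ter_op)"
  note * = totally_associativeD[OF this]
  \<comment> \<open>Replacing \<open>1/3\<close> by a variable with \<open>3 h = 1\<close> leaves a pure ring identity.\<close>
  define h :: 'a where "h = 1 / 3"
  have h: "3 * h = 1" "2 / 3 = 2 * h"
    using 3 by (simp_all add: h_def)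
  have "h\<^sup>2 = 0"
    using *(1)[of e1 e1 e1 e1 e1 2] h(1)
    unfolding B_nth e_nth h(2) h_def[symmetric] by algebra
  then show False using h(1) by simp
qed

lemma B10_not_totally_associative:
  assumes 2: "(2::'a::field) \<noteq> 0"
  shows "\<not> totally_associative (B10 :: 'a ter_op)"
proof
  assume "totally_associative (B10 :: 'a ter_op)"
  note * = totally_associativeD[OF this]
  have "(2::'a) = 0"
    using *(1)[of e1 e2 e2 e2 e2 1] by (simp add: B_nth e_nth)
  then show False using 2 by contradiction
qed

lemma B11_not_totally_associative:
  assumes 2: "(2::'a::field) \<noteq> 0"
  shows "\<not> totally_associative (B11 :: 'a ter_op)"
proof
  assume "totally_associative (B11 :: 'a ter_op)"
  note * = totally_associativeD[OF this]
  have "(2::'a) = 0"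
    using *(1)[of e1 e1 e2 e1 e1 2] by (simp add: B_nth e_nth)
  then show False using 2 by contradiction
qed

section \<open>Matrices of structure constants and the classification\<close>

lemma prime_neq_0:
  assumes "prime p" "CHAR('a::field) \<noteq> p"
  shows "of_nat p \<noteq> (0 :: 'a)"
proof -
  have "CHAR('a) \<noteq> 1" using CHAR_not_1[where 'a='a] by simp
  then show ?thesis using assms by (metis of_nat_eq_0_iff_char_dvd prime_nat_iff)
qed

lemma structure_matrix_eqI:
  assumes "f e1 e1 e1 = vector [a1, b1]" "f e1 e1 e2 = vector [a2, b2]"
    "f e1 e2 e1 = vector [a3, b3]" "f e1 e2 e2 = vector [a4, b4]"
    "f e2 e1 e1 = vector [a5, b5]" "f e2 e1 e2 = vector [a6, b6]"
    "f e2 e2 e1 = vector [a7, b7]" "f e2 e2 e2 = vector [a8, b8]"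
  shows "structure_matrix f = vector
    [vector [a1, a2, a3, a4, a5, a6, a7, a8], vector [b1, b2, b3, b4, b5, b6, b7, b8]]"
  by (simp add: structure_matrix_def assms vec_eq_iff forall_2 forall_8 transpose_def vector_8_nth)

theorem mainTheorem3:
  assumes "CHAR('a::alg_closed_field) \<noteq> 2" and "CHAR('a) \<noteq> 3"
  shows
    "(\<forall>\<alpha>1 \<alpha>2 \<alpha>4 \<beta>1 :: 'a. \<not> totally_associative (B1 \<alpha>1 \<alpha>2 \<alpha>4 \<beta>1)) \<and>
     (\<forall>\<alpha>1 \<beta>1 \<beta>2 :: 'a. totally_associative (B2 \<alpha>1 \<beta>1 \<beta>2) \<longleftrightarrow>
        (\<alpha>1, \<beta>1, \<beta>2) \<in> {(0, 0, 0), (1/2, 0, - (1/2)), (1/2, 0, 1/2)}) \<and>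
     (\<forall>\<beta>1 \<beta>2 :: 'a. \<not> totally_associative (B3 \<beta>1 \<beta>2)) \<and>
     (\<forall>\<alpha>1 \<beta>2 :: 'a. totally_associative (B4 \<alpha>1 \<beta>2) \<longleftrightarrow>
        (\<alpha>1, \<beta>2) \<in> {(0, 0), (1/2, - (1/2)), (1/2, 0), (1/2, 1/2), (1, - 1), (1, 0), (1, 1)}) \<and>
     (\<forall>\<alpha>1 :: 'a. \<not> totally_associative (B5 \<alpha>1)) \<and>
     (\<forall>\<alpha>1 \<beta>1 :: 'a. \<not> totally_associative (B6 \<alpha>1 \<beta>1)) \<and>
     (\<forall>\<beta>1 :: 'a. \<not> totally_associative (B7 \<beta>1)) \<and>
     (\<forall>\<alpha>1 :: 'a. \<not> totally_associative (B8 \<alpha>1)) \<and>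
     \<not> totally_associative (B9 :: 'a ter_op) \<and>
     \<not> totally_associative (B10 :: 'a ter_op) \<and>
     \<not> totally_associative (B11 :: 'a ter_op) \<and>

     structure_matrix (B2 0 0 0 :: 'a ter_op) = vector
       [vector [0, 0, 0, 0, 0, 0, 1, 0],
        vector [0, 0, 0, 0, 0, 0, 0, 1]] \<and>
     structure_matrix (B2 (1/2) 0 (- (1/2)) :: 'a ter_op) = vector
       [vector [1/4, 0, 0, 1/2, 0, - (1/2), 1/2, 0],
        vector [0, 1/4, - (1/4), 0, 1/4, 0, 0, 1/2]] \<and>
     structure_matrix (B2 (1/2) 0 (1/2) :: 'a ter_op) = vector
       [vector [1/4, 0, 0, 1/2, 0, 1/2, 1/2, 0],
        vector [0, 1/4, 1/4, 0, 1/4, 0, 0, 1/2]] \<and>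
     structure_matrix (B4 (1/2) (- (1/2)) :: 'a ter_op) = vector
       [vector [1/4, 0, 0, 0, 0, 0, 0, 0],
        vector [0, 1/4, - (1/4), 0, 1/4, 0, 0, 0]] \<and>
     structure_matrix (B4 (1/2) 0 :: 'a ter_op) = vector
       [vector [1/4, 0, 0, 0, 0, 0, 0, 0],
        vector [0, 0, 0, 0, 1/4, 0, 0, 0]] \<and>
     structure_matrix (B4 (1/2) (1/2) :: 'a ter_op) = vector
       [vector [1/4, 0, 0, 0, 0, 0, 0, 0],
        vector [0, 1/4, 1/4, 0, 1/4, 0, 0, 0]] \<and>
     B4 1 (- 1) = (B4 1 1 :: 'a ter_op) \<and>
     structure_matrix (B4 1 1 :: 'a ter_op) = vector
       [vector [1, 0, 0, 0, 0, 0, 0, 0],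
        vector [0, 1, 0, 0, 0, 0, 0, 0]] \<and>
     structure_matrix (B4 1 0 :: 'a ter_op) = vector
       [vector [1, 0, 0, 0, 0, 0, 0, 0],
        vector [0, 0, 0, 0, 0, 0, 0, 0]] \<and>

     (\<forall>f \<in> {B2 0 0 0, B2 (1/2) 0 (- (1/2)), B2 (1/2) 0 (1/2),
             B4 (1/2) (- (1/2)), B4 (1/2) 0, B4 (1/2) (1/2),
             B4 1 (- 1), B4 1 1, B4 1 0 :: 'a ter_op}.
        totally_associative f \<and> f \<noteq> (\<lambda>x y z. 0)) \<and>
     B4 0 0 = (\<lambda>x y z. 0 :: 'a ^ 2)"
proof -
  have 2: "(2::'a) \<noteq> 0"
    using prime_neq_0[OF two_is_prime_nat assms(1)] by simp
  have 3: "(3::'a) \<noteq> 0"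
    using prime_neq_0[of 3, OF _ assms(2)] by simp
  have "(2::'a) * 2 \<noteq> 0" using 2 by (rule no_zero_divisors) (rule 2)
  then have 4: "(4::'a) \<noteq> 0" by simp
  show ?thesis
  proof (intro conjI)
    show "\<forall>\<alpha>1 \<alpha>2 \<alpha>4 \<beta>1 :: 'a. \<not> totally_associative (B1 \<alpha>1 \<alpha>2 \<alpha>4 \<beta>1)"
      using B1_not_totally_associative by blast
    show "\<forall>\<alpha>1 \<beta>1 \<beta>2 :: 'a. totally_associative (B2 \<alpha>1 \<beta>1 \<beta>2) \<longleftrightarrow>
        (\<alpha>1, \<beta>1, \<beta>2) \<in> {(0, 0, 0), (1/2, 0, - (1/2)), (1/2, 0, 1/2)}"
      using B2_necessary B2_sufficient 2 by blast
    show "\<forall>\<beta>1 \<beta>2 :: 'a. \<not> totally_associative (B3 \<beta>1 \<beta>2)"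
      using B3_not_totally_associative 2 by blast
    show "\<forall>\<alpha>1 \<beta>2 :: 'a. totally_associative (B4 \<alpha>1 \<beta>2) \<longleftrightarrow> (\<alpha>1, \<beta>2) \<in>
        {(0, 0), (1/2, - (1/2)), (1/2, 0), (1/2, 1/2), (1, - 1), (1, 0), (1, 1)}"
      using B4_necessary B4_sufficient 2 by blast
    show "\<forall>\<alpha>1 :: 'a. \<not> totally_associative (B5 \<alpha>1)" using B5_not_totally_associative 2 by blast
    show "\<forall>\<alpha>1 \<beta>1 :: 'a. \<not> totally_associative (B6 \<alpha>1 \<beta>1)"
      using B6_not_totally_associative 2 by blast
    show "\<forall>\<beta>1 :: 'a. \<not> totally_associative (B7 \<beta>1)" using B7_not_totally_associative by blast
    show "\<forall>\<alpha>1 :: 'a. \<not> totally_associative (B8 \<alpha>1)" using B8_not_totally_associative 2 by blast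
    show "\<not> totally_associative (B9 :: 'a ter_op)" using B9_not_totally_associative 3 by blast
    show "\<not> totally_associative (B10 :: 'a ter_op)" using B10_not_totally_associative 2 by blast
    show "\<not> totally_associative (B11 :: 'a ter_op)" using B11_not_totally_associative 2 by blast
    show "B4 0 0 = (\<lambda>x y z. 0 :: 'a ^ 2)" by (rule B4_0_0)
    show "B4 1 (- 1) = (B4 1 1 :: 'a ter_op)"
      by (intro ext) (simp add: vec_eq_iff forall_2 B_nth)
    have nonzero: "f \<noteq> (\<lambda>x y z. 0)" if "f x y z $ i \<noteq> 0" for f :: "'a ter_op" and x y z i
      using that by auto
    have "B2 0 0 0 \<noteq> (\<lambda>x y z. 0 :: 'a ^ 2)"
      by (rule nonzero[of _ e2 e2 e1 1]) (simp add: B_nth e_nth)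
    moreover have "B2 (1/2) 0 c \<noteq> (\<lambda>x y z. 0)" "B4 (1/2) c \<noteq> (\<lambda>x y z. 0)"
        "B4 1 c \<noteq> (\<lambda>x y z. 0)" for c :: 'a
      by (rule nonzero[of _ e1 e1 e1 1], use 2 4 in \<open>simp add: B_nth e_nth\<close>)+
    ultimately show "\<forall>f \<in> {B2 0 0 0, B2 (1/2) 0 (- (1/2)), B2 (1/2) 0 (1/2),
               B4 (1/2) (- (1/2)), B4 (1/2) 0, B4 (1/2) (1/2),
               B4 1 (- 1), B4 1 1, B4 1 0 :: 'a ter_op}.
          totally_associative f \<and> f \<noteq> (\<lambda>x y z. 0)"
      using B2_sufficient[OF _ 2] B4_sufficient[OF _ 2] by simp
  qed (rule structure_matrix_eqI;
      use 2 4 in \<open>simp add: vec_eq_iff forall_2 B_nth e_nth field_simps\<close>)+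
qed

end
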